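(* Let $\mathcal{S}=\mathcal{L}\oplus\mathcal{F}^{-1/2}$ be the Krichever–Novikov Lie superalgebra of $(\Sigma,A,L)$ with the almost-grading induced by a splitting $A=I\cup O$. Let $c$ be an even super-cocycle of $\mathcal{S}$ (i.e. a cocycle for an even central element) which is bounded from above and which vanishes on the vector field subalgebra $\mathcal{L}$ (i.e. $c(e,f)=0$ for all $e,f\in\mathcal{L}$). Then $c$ vanishes identically on $\mathcal{S}\times\mathcal{S}$. In other words, every bounded even cocycle of $\mathcal{S}$ is uniquely determined by its restriction to $\mathcal{L}$.
   Context: **Algebras.** $\Sigma$ is a compact Riemann surface of arbitrary genus $g$, $A\subset\Sigma$ a finite set, $\mathcal{K}$ the canonical line bundle, $L$ a fixed line bundle with $L^{\otimes 2}=\mathcal{K}$ (theta characteristic). For $\lambda\in\frac12\mathbb{Z}$, $\mathcal{K}^\lambda:=L^{\otimes 2\lambda}$ (negative powers via the dual bundle), and $\mathcal{F}^\lambda$ is the complex vector space of global meromorphic sections of $\mathcal{K}^\lambda$ holomorphic on $\Sigma\setminus A$. Locally elements are $f(z)(dz)^\lambda$; the same symbol is used for a section and its local representing function, and $'$ is $d/dz$. $\mathcal{L}:=\mathcal{F}^{-1}$ (vector fields) with the Lie bracket $[e,f]=(ef'-fe')\frac{d}{dz}$. For $e\in\mathcal{L}$, $\varphi\in\mathcal{F}^{-1/2}$: $e.\varphi=(e\varphi'-\frac12\varphi e')(dz)^{-1/2}$. For $\varphi,\psi\in\mathcal{F}^{-1/2}$, $\varphi\cdot\psi\in\mathcal{L}$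 is the product of sections. $\mathcal{S}:=\mathcal{L}\oplus\mathcal{F}^{-1/2}$, with even part $\mathcal{S}_{\bar0}=\mathcal{L}$, odd part $\mathcal{S}_{\bar1}=\mathcal{F}^{-1/2}$, is the Lie superalgebra with bracket extending that of $\mathcal{L}$ by $[e,\varphi]=-[\varphi,e]=e.\varphi$, $[\varphi,\psi]=\varphi\cdot\psi$. **Cocycles (even central element).** An even super-cocycle is a bilinear $c:\mathcal{S}\times\mathcal{S}\to\mathbb{C}$ vanishing on pairs of elements of different parity, with $c(x,y)=-(-1)^{\bar x\bar y}c(y,x)$ and $$(-1)^{\bar x\bar z}c(x,[y,z])+(-1)^{\bar y\bar x}c(y,[z,x])+(-1)^{\bar z\bar y}c(z,[x,y])=0$$ for $x,y,z$ of pure parity. **Almost-grading.** $A=I\cup O$ is a fixed splitting into nonempty disjoint sets $I=\{P_1,\dots,P_K\}$, $O=\{Q_1,\dots,Q_M\}$. A separating cycle $C_S$ is a smooth cycle in $\Sigma\setminus A$ homologous there to the sum of small positively oriented circles around the points $P_i$. The Krichever–Novikov pairing is $\mathcal{F}^\lambda\times\mathcal{F}^{1-\lambda}\to\mathbb{C}$, $\langle f,g\rangle=\frac1{2\pi\mathrm{i}}\int_{C_S}f\cdot g$. Let $\mathbb{J}_\lambda=\mathbb{Z}$ for $\lambda\in\mathbb{Z}$, $\mathbb{J}_\lambda=\mathbb{Z}+\frac12$ for $\lambda\in\mathbb{Z}+\frac12$. Fix local coordinates $z_p$ centered at $P_p$. One fixes Krichever–Novikov bases $\{f^\lambda_{n,p}\mid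 n\in\mathbb{J}_\lambda,\ 1\le p\le K\}$ of $\mathcal{F}^\lambda$ (known to exist; needed for $\lambda\in\{-1,-\frac12,\frac32,2\}$) with: (1) $\mathrm{ord}_{P_i}(f^\lambda_{n,p})\ge(n+1-\lambda)-\delta_i^p$ for all $i$ (with equality generically), and $f^\lambda_{n,p}=z_p^{\,n-\lambda}(1+O(z_p))(dz_p)^\lambda$ near $P_p$; (2) duality $\langle f^\lambda_{n,p},f^{1-\lambda}_{-m,r}\rangle=\delta_p^r\delta_n^m$; (3) at the out-points, $\mathrm{ord}_{Q_j}(f^\lambda_{n,p})\ge-\alpha_j n-B$ for all $n,p,j$, with constants $\alpha_j>0$, $\sum_j\alpha_j=K$, and $B$ independent of $n,p,\lambda$. Put $\mathcal{F}^\lambda_n=\mathrm{span}\{f^\lambda_{n,p}\mid p=1,\dots,K\}$, and for $n\in\frac12\mathbb{Z}$ let $\mathcal{S}_n=\mathcal{F}^{-1}_n$ if $n\in\mathbb{Z}$, $\mathcal{S}_n=\mathcal{F}^{-1/2}_n$ if $n\in\mathbb{Z}+\frac12$. Then $\mathcal{S}=\bigoplus_n\mathcal{S}_n$ is almost-graded: $\dim\mathcal{S}_n<\infty$ and there are constants $L_1,L_2$ with $[\mathcal{S}_n,\mathcal{S}_m]\subseteq\bigoplus_{h=n+m-L_1}^{n+m+L_2}\mathcal{S}_h$ for all $n,m$. **Bounded.** A cocycle $c$ is bounded (from above) if there is $M_2\in\mathbb{Z}$ such that for all $n,m$: $c(\mathcal{S}_n,\mathcal{S}_m)\ne0\Rightarrow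 n+m\le M_2$. *)

theory Defs
  imports
    "HOL-Complex_Analysis.Complex_Analysis"
    "HOL-Homology.Homology"
    "HOL-Library.Function_Algebras"
    "HOL-Library.Landau_Symbols"
begin

text \<open>
  The underlying space is a whole type \<open>'a\<close> of class \<open>t2_space\<close>. The atlas is an arbitrary, not
  necessarily maximal, family of charts indexed by a type \<open>'i\<close>.
\<close>

record ('a, 'i) atlas =
  chart_dom :: "'i \<Rightarrow> 'a set"
  chart_map :: "'i \<Rightarrow> 'a \<Rightarrow> complex"

definition chart_image :: "('a, 'i) atlas \<Rightarrow> 'i \<Rightarrow> complex set" where
  "chart_image X i = chart_map X i ` chart_dom X i"

definition chart_inv :: "('a, 'i) atlas \<Rightarrow> 'i \<Rightarrow> complex \<Rightarrow> 'a" where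
  "chart_inv X i = the_inv_into (chart_dom X i) (chart_map X i)"

definition riemann_surface :: "('a::t2_space, 'i) atlas \<Rightarrow> bool" where
  "riemann_surface X \<longleftrightarrow>
     connected (UNIV :: 'a set) \<and>
     (\<Union>i. chart_dom X i) = UNIV \<and>
     (\<forall>i. open (chart_dom X i) \<and> open (chart_image X i) \<and> inj_on (chart_map X i) (chart_dom X i) \<and>
          homeomorphism (chart_dom X i) (chart_image X i) (chart_map X i) (chart_inv X i)) \<and>
     (\<forall>i j. (chart_map X j \<circ> chart_inv X i)
              holomorphic_on chart_map X i ` (chart_dom X i \<inter> chart_dom X j))"

definition compact_riemann_surface :: "('a::t2_space, 'i) atlas \<Rightarrow> bool" where
  "compact_riemann_surface X \<longleftrightarrow> riemann_surface X \<and> compact (UNIV :: 'a set)"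

text \<open>
  A line bundle trivialised over the chart domains is given by its transition functions \<open>G i j\<close>:
  if \<open>b\<^sub>i\<close>, \<open>b\<^sub>j\<close> are the local frames, then \<open>b\<^sub>j = G i j \<cdot> b\<^sub>i\<close>, so that the local functions
  of a section are related by \<open>s\<^sub>i = G i j \<cdot> s\<^sub>j\<close>. Values of \<open>G i j\<close> outside
  the overlap of the two domains are irrelevant. Since charts may always be shrunk, every holomorphic
  line bundle is of this form for a suitable atlas.
\<close>

type_synonym ('a, 'i) transition = "'i \<Rightarrow> 'i \<Rightarrow> 'a \<Rightarrow> complex"

definition line_bundle :: "('a, 'i) atlas \<Rightarrow> ('a, 'i) transition \<Rightarrow> bool" where
  "line_bundle X G \<longleftrightarrow>
     (\<forall>i j. (G i j \<circ> chart_inv X i)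
              holomorphic_on chart_map X i ` (chart_dom X i \<inter> chart_dom X j)) \<and>
     (\<forall>i j. \<forall>x \<in> chart_dom X i \<inter> chart_dom X j. G i j x \<noteq> 0) \<and>
     (\<forall>i j k. \<forall>x \<in> chart_dom X i \<inter> chart_dom X j \<inter> chart_dom X k. G i k x = G i j x * G j k x)"

text \<open>The frames of the canonical bundle are the \<open>dz\<^sub>i\<close>, and \<open>dz\<^sub>j = (dz\<^sub>j/dz\<^sub>i) dz\<^sub>i\<close>.\<close>

definition canonical_bundle :: "('a, 'i) atlas \<Rightarrow> ('a, 'i) transition" where
  "canonical_bundle X = (\<lambda>i j x. deriv (chart_map X j \<circ> chart_inv X i) (chart_map X i x))"

text \<open>
  A theta characteristic is a line bundle \<open>L\<close> whose square is the canonical bundle. The frame of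
  \<open>L\<close> over the \<open>i\<close>-th chart plays the role of \<open>(dz\<^sub>i)\<^sup>1\<^sup>/\<^sup>2\<close>: its square is \<open>dz\<^sub>i\<close>. Over simply
  connected charts such a frame exists for every bundle with \<open>L \<otimes> L = K\<close>, because the nowhere
  vanishing function comparing the square of an arbitrary frame with \<open>dz\<^sub>i\<close> has a holomorphic
  square root.
\<close>

definition theta_characteristic :: "('a, 'i) atlas \<Rightarrow> ('a, 'i) transition \<Rightarrow> bool" where
  "theta_characteristic X L \<longleftrightarrow>
     line_bundle X L \<and>
     (\<forall>i j. \<forall>x \<in> chart_dom X i \<inter> chart_dom X j. (L i j x)\<^sup>2 = canonical_bundle X i j x)"

text \<open>The power \<open>K^lam = L^(2 * lam)\<close> for \<open>lam \<in> \<int>/2\<close>; its frames play the role of \<open>(dz\<^sub>i)^lam\<close>.\<close>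

definition bundle_power :: "('a, 'i) transition \<Rightarrow> real \<Rightarrow> ('a, 'i) transition" where
  "bundle_power L lam = (\<lambda>i j x. L i j x powi \<lfloor>2 * lam\<rfloor>)"

text \<open>
  A section is represented by the family of its local functions in the coordinates \<open>z\<^sub>i\<close>. As
  functions are total, the local function is set to \<open>0\<close> off the image of \<open>chart_dom X i - A\<close>, in
  particular at the points of \<open>A\<close>. Being meromorphic there only concerns punctured neighbourhoods,
  so the convention merely ensures that equality of representing families is equality of sections.
\<close>

type_synonym 'i sect = "'i \<Rightarrow> complex \<Rightarrow> complex"

definition mero_sections ::
    "('a, 'i) atlas \<Rightarrow> 'a set \<Rightarrow> ('a, 'i) transition \<Rightarrow> 'i sect set" where
  "mero_sections X A G = {s.
     (\<forall>i. s i meromorphic_on chart_image X i) \<and>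
     (\<forall>i. s i holomorphic_on chart_map X i ` (chart_dom X i - A)) \<and>
     (\<forall>i. \<forall>w. w \<notin> chart_map X i ` (chart_dom X i - A) \<longrightarrow> s i w = 0) \<and>
     (\<forall>i j. \<forall>x \<in> chart_dom X i \<inter> chart_dom X j - A.
        s i (chart_map X i x) = G i j x * s j (chart_map X j x))}"

definition FF ::
    "('a, 'i) atlas \<Rightarrow> ('a, 'i) transition \<Rightarrow> 'a set \<Rightarrow> real \<Rightarrow> 'i sect set" where
  "FF X L A lam = mero_sections X A (bundle_power L lam)"

definition sect_scale :: "complex \<Rightarrow> 'i sect \<Rightarrow> 'i sect" where
  "sect_scale a s = (\<lambda>i w. a * s i w)"

global_interpretation sect: vector_space "sect_scale :: complex \<Rightarrow> 'i sect \<Rightarrow> 'i sect"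
  by unfold_locales (auto simp: sect_scale_def fun_eq_iff algebra_simps)

text \<open>
  The order of a section at \<open>x\<close> is at least \<open>r\<close>. The order does not depend on the chart around \<open>x\<close>.
  As \<open>zorder\<close> is unspecified for the zero function, this is meant for nonzero sections only.
\<close>

definition ord_ge :: "('a, 'i) atlas \<Rightarrow> 'i sect \<Rightarrow> 'a \<Rightarrow> real \<Rightarrow> bool" where
  "ord_ge X s x r \<longleftrightarrow>
     (\<forall>i. x \<in> chart_dom X i \<longrightarrow> r \<le> real_of_int (zorder (s i) (chart_map X i x)))"

definition sect_mult :: "'i sect \<Rightarrow> 'i sect \<Rightarrow> 'i sect" where
  "sect_mult s t = (\<lambda>i w. s i w * t i w)"

definition vf_bracket :: "'i sect \<Rightarrow> 'i sect \<Rightarrow> 'i sect" where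
  "vf_bracket e f = (\<lambda>i w. e i w * deriv (f i) w - f i w * deriv (e i) w)"

definition vf_act :: "'i sect \<Rightarrow> 'i sect \<Rightarrow> 'i sect" where
  "vf_act e \<phi> = (\<lambda>i w. e i w * deriv (\<phi> i) w - 1/2 * \<phi> i w * deriv (e i) w)"

text \<open>Elements of the superalgebra are pairs of a vector field and a \<open>(-1/2)\<close>-form.\<close>

definition SS :: "('a, 'i) atlas \<Rightarrow> ('a, 'i) transition \<Rightarrow> 'a set \<Rightarrow> ('i sect \<times> 'i sect) set" where
  "SS X L A = FF X L A (-1) \<times> FF X L A (-1/2)"

definition SS_par ::
    "('a, 'i) atlas \<Rightarrow> ('a, 'i) transition \<Rightarrow> 'a set \<Rightarrow> nat \<Rightarrow> ('i sect \<times> 'i sect) set" where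
  "SS_par X L A k = (if k = 0 then FF X L A (-1) \<times> {0} else {0} \<times> FF X L A (-1/2))"

definition super_scale :: "complex \<Rightarrow> 'i sect \<times> 'i sect \<Rightarrow> 'i sect \<times> 'i sect" where
  "super_scale a x = (sect_scale a (fst x), sect_scale a (snd x))"

definition super_bracket ::
    "'i sect \<times> 'i sect \<Rightarrow> 'i sect \<times> 'i sect \<Rightarrow> 'i sect \<times> 'i sect" where
  "super_bracket x y =
     (vf_bracket (fst x) (fst y) + sect_mult (snd x) (snd y),
      vf_act (fst x) (snd y) - vf_act (fst y) (snd x))"

text \<open>
  Cocycles are total functions on the ambient type; only their values on \<open>SS X L A\<close> matter.
\<close>

type_synonym 'i cochain = "'i sect \<times> 'i sect \<Rightarrow> 'i sect \<times> 'i sect \<Rightarrow> complex"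

definition bilinear_on_SS ::
    "('a, 'i) atlas \<Rightarrow> ('a, 'i) transition \<Rightarrow> 'a set \<Rightarrow> 'i cochain \<Rightarrow> bool" where
  "bilinear_on_SS X L A c \<longleftrightarrow>
     (\<forall>x \<in> SS X L A. \<forall>y \<in> SS X L A. \<forall>z \<in> SS X L A. \<forall>a.
        c (x + y) z = c x z + c y z \<and> c z (x + y) = c z x + c z y \<and>
        c (super_scale a x) z = a * c x z \<and> c z (super_scale a x) = a * c z x)"

definition even_super_cocycle ::
    "('a, 'i) atlas \<Rightarrow> ('a, 'i) transition \<Rightarrow> 'a set \<Rightarrow> 'i cochain \<Rightarrow> bool" where
  "even_super_cocycle X L A c \<longleftrightarrow>
     bilinear_on_SS X L A c \<and>
     (\<forall>k \<in> {0, 1}. \<forall>l \<in> {0, 1}. \<forall>x \<in> SS_par X L A k. \<forall>y \<in> SS_par X L A l.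
        (k \<noteq> l \<longrightarrow> c x y = 0) \<and> c x y = - ((-1) ^ (k * l) * c y x)) \<and>
     (\<forall>k \<in> {0, 1}. \<forall>l \<in> {0, 1}. \<forall>m \<in> {0, 1}.
        \<forall>x \<in> SS_par X L A k. \<forall>y \<in> SS_par X L A l. \<forall>z \<in> SS_par X L A m.
          (-1) ^ (k * m) * c x (super_bracket y z)
        + (-1) ^ (l * k) * c y (super_bracket z x)
        + (-1) ^ (m * l) * c z (super_bracket x y) = 0)"

text \<open>
  Singular 1-simplices are maps on \<open>standard_simplex 1\<close>; the corresponding path runs from
  vertex 0 to vertex 1, so that the boundary is end point minus starting point.
\<close>

definition simplex_path :: "((nat \<Rightarrow> real) \<Rightarrow> 'a) \<Rightarrow> real \<Rightarrow> 'a" where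
  "simplex_path \<sigma> t = \<sigma> (\<lambda>k. if k = 0 then 1 - t else if k = 1 then t else 0)"

definition smooth_curve :: "('a, 'i) atlas \<Rightarrow> (real \<Rightarrow> 'a) \<Rightarrow> bool" where
  "smooth_curve X \<gamma> \<longleftrightarrow>
     (\<forall>i. (\<forall>t \<in> {0..1}. \<gamma> t \<in> chart_dom X i \<longrightarrow>
            (chart_map X i \<circ> \<gamma>) differentiable (at t within {0..1})) \<and>
          continuous_on {t \<in> {0..1}. \<gamma> t \<in> chart_dom X i}
            (\<lambda>t. vector_derivative (chart_map X i \<circ> \<gamma>) (at t within {0..1})))"

text \<open>
  Integral of a 1-form \<open>\<omega>\<^sub>i dz\<^sub>i\<close> along a curve. For a section of the canonical bundle the integrand
  at \<open>t\<close> does not depend on the choice of the chart around \<open>\<gamma> t\<close>.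
\<close>

definition form_integral :: "('a, 'i) atlas \<Rightarrow> 'i sect \<Rightarrow> (real \<Rightarrow> 'a) \<Rightarrow> complex" where
  "form_integral X \<omega> \<gamma> = integral {0..1} (\<lambda>t.
     let i = (SOME i. \<gamma> t \<in> chart_dom X i)
     in \<omega> i (chart_map X i (\<gamma> t)) * vector_derivative (chart_map X i \<circ> \<gamma>) (at t within {0..1}))"

definition chain_integral :: "('a, 'i) atlas \<Rightarrow> 'i sect \<Rightarrow> 'a chain \<Rightarrow> complex" where
  "chain_integral X \<omega> C = (\<Sum>\<sigma> \<in> Poly_Mapping.keys C.
     of_int (Poly_Mapping.lookup C \<sigma>) * form_integral X \<omega> (simplex_path \<sigma>))"

definition chart_circle :: "('a, 'i) atlas \<Rightarrow> 'i \<Rightarrow> real \<Rightarrow> (nat \<Rightarrow> real) \<Rightarrow> 'a" where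
  "chart_circle X i r = restrict
     (\<lambda>x. chart_inv X i (of_real r * exp (2 * of_real pi * \<i> * of_real (x 1)))) (standard_simplex 1)"

text \<open>
  \<open>ch p\<close> is the index of the fixed chart centred at \<open>p\<close>. The radii are small enough for the closed
  coordinate discs to exist and to contain no other point of \<open>A\<close>.
\<close>

definition separating_cycle ::
    "('a::t2_space, 'i) atlas \<Rightarrow> 'a set \<Rightarrow> 'a set \<Rightarrow> ('a \<Rightarrow> 'i) \<Rightarrow> 'a chain \<Rightarrow> bool" where
  "separating_cycle X Ins A ch C \<longleftrightarrow>
     singular_relcycle 1 (top_of_set (- A)) {} C \<and>
     (\<forall>\<sigma> \<in> Poly_Mapping.keys C. smooth_curve X (simplex_path \<sigma>)) \<and>
     (\<exists>\<rho>. (\<forall>p \<in> Ins. 0 < \<rho> p \<and> cball 0 (\<rho> p) \<subseteq> chart_image X (ch p) \<and>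
             chart_inv X (ch p) ` cball 0 (\<rho> p) \<inter> A = {p}) \<and>
          homologous_rel 1 (top_of_set (- A)) {} C
            (\<Sum>p \<in> Ins. frag_of (chart_circle X (ch p) (\<rho> p))))"

definition kn_pairing :: "('a, 'i) atlas \<Rightarrow> 'a chain \<Rightarrow> 'i sect \<Rightarrow> 'i sect \<Rightarrow> complex" where
  "kn_pairing X C f g = 1 / (2 * of_real pi * \<i>) * chain_integral X (sect_mult f g) C"

text \<open>\<open>\<int>\<close> for integral \<open>lam\<close> and \<open>\<int> + 1/2\<close> for \<open>lam \<in> \<int> + 1/2\<close>.\<close>

definition JJ :: "real \<Rightarrow> real set" where
  "JJ lam = {n. n - lam \<in> \<int>}"

text \<open>
  The in-points themselves serve as the second index of the basis elements \<open>f lam n p\<close>. For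
  \<open>n \<in> JJ lam\<close> the number \<open>n - lam\<close> is an integer, so the floor below is no rounding.
\<close>

definition kn_basis ::
    "('a, 'i) atlas \<Rightarrow> ('a, 'i) transition \<Rightarrow> 'a set \<Rightarrow> 'a set \<Rightarrow> real \<Rightarrow> (real \<Rightarrow> 'a \<Rightarrow> 'i sect) \<Rightarrow> bool"
  where
  "kn_basis X L Ins A lam b \<longleftrightarrow>
     inj_on (\<lambda>(n, p). b n p) (JJ lam \<times> Ins) \<and>
     sect.independent ((\<lambda>(n, p). b n p) ` (JJ lam \<times> Ins)) \<and>
     sect.span ((\<lambda>(n, p). b n p) ` (JJ lam \<times> Ins)) = FF X L A lam"

definition kn_bases ::
    "('a, 'i) atlas \<Rightarrow> ('a, 'i) transition \<Rightarrow> 'a set \<Rightarrow> 'a set \<Rightarrow> ('a \<Rightarrow> 'i) \<Rightarrow> 'a chain \<Rightarrow>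
     (real \<Rightarrow> real \<Rightarrow> 'a \<Rightarrow> 'i sect) \<Rightarrow> bool" where
  "kn_bases X L Ins Outs ch C f \<longleftrightarrow>
     (\<forall>lam \<in> {-1, -1/2, 3/2, 2}.
        kn_basis X L Ins (Ins \<union> Outs) lam (f lam) \<and>
        (\<forall>n \<in> JJ lam. \<forall>p \<in> Ins.
           (\<forall>q \<in> Ins. ord_ge X (f lam n p) q ((n + 1 - lam) - (if q = p then 1 else 0))) \<and>
           (\<lambda>w. f lam n p (ch p) w / w powi \<lfloor>n - lam\<rfloor> - 1) \<in> O[at 0](\<lambda>w. w)) \<and>
        (\<forall>n \<in> JJ lam. \<forall>m \<in> JJ lam. \<forall>p \<in> Ins. \<forall>r \<in> Ins.
           kn_pairing X C (f lam n p) (f (1 - lam) (- m) r) = (if p = r \<and> n = m then 1 else 0))) \<and>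
     (\<exists>\<alpha> B. (\<forall>q \<in> Outs. 0 < \<alpha> q) \<and> (\<Sum>q \<in> Outs. \<alpha> q) = real (card Ins) \<and>
        (\<forall>lam \<in> {-1, -1/2, 3/2, 2}. \<forall>n \<in> JJ lam. \<forall>p \<in> Ins. \<forall>q \<in> Outs.
           ord_ge X (f lam n p) q (- \<alpha> q * n - B)))"

definition SS_deg ::
    "'a set \<Rightarrow> (real \<Rightarrow> real \<Rightarrow> 'a \<Rightarrow> 'i sect) \<Rightarrow> real \<Rightarrow> ('i sect \<times> 'i sect) set" where
  "SS_deg Ins f n =
     (if n \<in> \<int> then sect.span (f (-1) n ` Ins) \<times> {0} else {0} \<times> sect.span (f (-1/2) n ` Ins))"

definition bounded_above ::
    "'a set \<Rightarrow> (real \<Rightarrow> real \<Rightarrow> 'a \<Rightarrow> 'i sect) \<Rightarrow> 'i cochain \<Rightarrow> bool" where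
  "bounded_above Ins f c \<longleftrightarrow>
     (\<exists>M2 :: int. \<forall>n m. 2 * n \<in> \<int> \<longrightarrow> 2 * m \<in> \<int> \<longrightarrow>
        (\<exists>x \<in> SS_deg Ins f n. \<exists>y \<in> SS_deg Ins f m. c x y \<noteq> 0) \<longrightarrow> n + m \<le> of_int M2)"

end

theory Submission
  imports Defs
begin

text \<open>
  Since \<open>c\<close> is even and vanishes on vector fields, all that is left of it is the symmetric bilinear
  form \<open>b \<phi> \<psi> = c (0, \<phi>) (0, \<psi>)\<close> on the \<open>(-1/2)\<close>-forms. The product of two such forms is
  a vector field, so the cocycle identity for a vector field \<open>e\<close> and two \<open>(-1/2)\<close>-forms loses its
  term \<open>c e (\<phi> \<cdot> \<psi>)\<close> and says that \<open>b\<close> is invariant: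
  \<open>b (e.\<phi>) \<psi> + b \<phi> (e.\<psi>) = 0\<close> (\<open>even_super_cocycle_invariant\<close>). The claim is therefore that an
  invariant symmetric form which is bounded from above is zero (\<open>bounded_imp_zero\<close>).

  Index the basis elements by their order at their own in-point: \<open>\<phi> N p\<close> begins with \<open>z\<^sub>p^N\<close> and
  \<open>e K p\<close> with \<open>z\<^sub>p^K\<close>, and at the other in-points the order is larger. From the local formula for
  the action, \<open>(e K p).(\<phi> N r)\<close> is \<open>\<delta>\<^sub>p\<^sub>r (N - K/2) \<phi> (N+K-1) p\<close> up to sections of order at least
  \<open>N + K\<close> at all in-points. Such a remainder is a combination of basis elements of order at least
  \<open>N + K\<close> (\<open>in_order_spanI\<close>), because the lowest-order part of a combination of basis elements can be
  read off from its leading coefficients.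

  Boundedness says that \<open>b (\<phi> N p) (\<phi> M q) = 0\<close> once \<open>N + M\<close> is large. Descend in the level
  \<open>s = N + M\<close>: if \<open>b\<close> vanishes above level \<open>s\<close>, the remainders drop out of the invariance
  equations, which become linear relations between the values at level \<open>s\<close>
  (\<open>top_level_relation\<close>). With \<open>K = 1\<close> they read \<open>(N - 1/2) b (\<phi> N p) (\<phi> M q) = 0\<close> for
  \<open>p \<noteq> q\<close> and \<open>(N + M - 1) b (\<phi> N p) (\<phi> M p) = 0\<close>. This leaves only \<open>N + M = 1\<close> at a common
  point, and there \<open>K = 2 - 2N\<close> applied to \<open>b (\<phi> N p) (\<phi> N p)\<close> yields
  \<open>2 (2N - 1) b (\<phi> (1-N) p) (\<phi> N p) = 0\<close>. All the factors are nonzero since \<open>N\<close> is an integer.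

  Uniqueness follows by applying this to the difference of two cocycles.
\<close>

section \<open>Leading coefficients at the origin\<close>

text \<open>
  The order of \<open>g\<close> at the origin is at least \<open>N\<close> and \<open>a\<close> is its coefficient of \<open>w^N\<close>. Allowing
  \<open>a = 0\<close> makes the notion additive and lets it cover the zero function, for which \<open>zorder\<close> says
  nothing.
\<close>
definition lead :: "int \<Rightarrow> complex \<Rightarrow> (complex \<Rightarrow> complex) \<Rightarrow> bool" where
  "lead N a g \<longleftrightarrow> ((\<lambda>w. g w / w powi N) \<longlongrightarrow> a) (at 0)"

lemma lead_unique: "lead N a g \<Longrightarrow> lead N b g \<Longrightarrow> a = b"
  unfolding lead_def by (rule tendsto_unique[OF at_neq_bot])

lemma lead_zero [simp]: "lead N 0 0" "lead N 0 (\<lambda>w. 0)"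
  by (simp_all add: lead_def zero_fun_def)

lemma lead_add: "lead N a g \<Longrightarrow> lead N b h \<Longrightarrow> lead N (a + b) (\<lambda>w. g w + h w)"
  unfolding lead_def by (drule (1) tendsto_add) (simp add: add_divide_distrib)

lemma lead_cmult: "lead N a g \<Longrightarrow> lead N (k * a) (\<lambda>w. k * g w)"
  unfolding lead_def by (drule tendsto_mult_left[of _ _ _ k]) simp

lemma lead_diff: "lead N a g \<Longrightarrow> lead N b h \<Longrightarrow> lead N (a - b) (\<lambda>w. g w - h w)"
  unfolding lead_def by (drule (1) tendsto_diff) (simp add: diff_divide_distrib)

lemma lead_mult:
  assumes "lead M a g" "lead N b h"
  shows "lead (M + N) (a * b) (\<lambda>w. g w * h w)"
proof -
  have "((\<lambda>w. g w / w powi M * (h w / w powi N)) \<longlongrightarrow> a * b) (at 0)"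
    using assms unfolding lead_def by (rule tendsto_mult)
  moreover have "\<forall>\<^sub>F w in at 0. g w / w powi M * (h w / w powi N) = g w * h w / w powi (M + N)"
    by (rule eventually_at_filter[THEN iffD2]) (simp add: power_int_add always_eventually)
  ultimately show ?thesis
    unfolding lead_def by (rule Lim_transform_eventually)
qed

lemma lead_lower:
  assumes "lead N a g" "M < N"
  shows "lead M 0 g"
proof -
  have "((\<lambda>w. 1 / w powi (M - N)) \<longlongrightarrow> (0::complex)) (at 0)"
  proof (rule Lim_transform_eventually)
    show "((\<lambda>w. w ^ nat (N - M)) \<longlongrightarrow> (0::complex)) (at 0)"
      using assms(2) by (auto intro!: tendsto_eq_intros)
    show "\<forall>\<^sub>F w in at 0. w ^ nat (N - M) = (1::complex) / w powi (M - N)"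
      using assms(2) by (simp add: power_int_def divide_inverse power_inverse)
  qed
  hence "lead (M - N) 0 (\<lambda>w. 1)"
    by (simp add: lead_def)
  from lead_mult[OF this assms(1)] show ?thesis by simp
qed

text \<open>
  Near the origin \<open>g w = w^N h(w)\<close> with \<open>h\<close> holomorphic after removal of its singularity, and
  \<open>h\<close> contributes only the term \<open>w^N h'(w)\<close> of higher order to the derivative.
\<close>
lemma lead_deriv:
  assumes g: "g meromorphic_on {0}" and "lead N a g"
  shows "lead (N - 1) (of_int N * a) (deriv g)"
proof -
  define h where "h = remove_sings (\<lambda>w. g w / w powi N)"
  have mero: "(\<lambda>w. g w / w powi N) meromorphic_on {0}"
    by (intro meromorphic_intros g)
  have lim: "((\<lambda>w. g w / w powi N) \<longlongrightarrow> a) (at 0)"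
    using assms(2) by (simp add: lead_def)
  have iso: "isolated_singularity_at (\<lambda>w. g w / w powi N) 0"
    using mero by (rule meromorphic_on_isolated_singularity)
  have h: "h analytic_on {0}"
    unfolding h_def using iso lim by (rule remove_sings_analytic_at)
  have h0: "(h \<longlongrightarrow> a) (at 0)"
  proof -
    have "h 0 = a" unfolding h_def using lim by (rule remove_sings_eqI)
    thus ?thesis using analytic_at_imp_isCont[OF h] by (simp add: isCont_def)
  qed
  obtain e where e: "e > 0" "h holomorphic_on ball 0 e"
    using h by (auto simp: analytic_on_def)
  have "\<forall>\<^sub>F w in at 0. h w = g w / w powi N"
    unfolding h_def by (rule eventually_remove_sings_eq_at[OF iso])
  then obtain d where d: "d > 0" "\<And>w. w \<noteq> 0 \<Longrightarrow> dist w 0 < d \<Longrightarrow> h w = g w / w powi N"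
    by (auto simp: eventually_at)
  define r where "r = min d e"
  have r: "r > 0" using d e by (simp add: r_def)
  have g_eq: "g w = w powi N * h w" if "w \<in> ball 0 r - {0}" for w
    using d(2)[of w] that by (auto simp: r_def)
  have dg: "deriv g w = of_int N * w powi (N - 1) * h w + w powi N * deriv h w"
    if w: "w \<in> ball 0 r - {0}" for w
  proof -
    have "h holomorphic_on ball 0 r" using e(2) by (rule holomorphic_on_subset) (auto simp: r_def)
    hence "(h has_field_derivative deriv h w) (at w)"
      using w by (intro holomorphic_derivI[of h "ball 0 r"]) auto
    hence "((\<lambda>w. w powi N * h w) has_field_derivative
             of_int N * w powi (N - 1) * h w + w powi N * deriv h w) (at w)"
      using w by (auto intro!: derivative_eq_intros)
    hence "(g has_field_derivative
             of_int N * w powi (N - 1) * h w + w powi N * deriv h w) (at w)"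
      by (rule has_field_derivative_transform_within_open[where S = "ball 0 r - {0}"])
         (use w g_eq in \<open>auto simp: open_delete\<close>)
    thus ?thesis by (rule DERIV_imp_deriv)
  qed
  have "isCont (deriv h) 0"
    using analytic_deriv[OF h] by (rule analytic_at_imp_isCont)
  hence "((\<lambda>w. of_int N * h w + w * deriv h w) \<longlongrightarrow> of_int N * a + 0 * deriv h 0) (at 0)"
    by (intro tendsto_intros h0) (auto simp: isCont_def)
  moreover have "\<forall>\<^sub>F w in at 0. of_int N * h w + w * deriv h w = deriv g w / w powi (N - 1)"
  proof -
    have "\<forall>\<^sub>F w in at 0. w \<in> ball 0 r - {0::complex}"
      using r eventually_at[of "\<lambda>w. w \<in> ball 0 r - {0::complex}" 0 UNIV]
      by (auto simp: dist_commute intro!: exI[of _ r])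
    thus ?thesis
    proof eventually_elim
      case (elim w)
      hence "w \<noteq> 0" by simp
      hence "w powi N = w * w powi (N - 1)" by (simp add: power_int_diff)
      thus ?case
        using \<open>w \<noteq> 0\<close> by (subst dg[OF elim]) (simp add: divide_simps algebra_simps)
    qed
  qed
  ultimately show ?thesis
    unfolding lead_def by (auto intro: Lim_transform_eventually)
qed

text \<open>
  A function vanishing near the origin has \<open>lead N 0\<close> for every \<open>N\<close>, whatever value \<open>zorder\<close> takes
  on it. Otherwise the zero or pole factors as \<open>w^n\<close> times a function continuous at the origin.
\<close>
lemma lead_zorder:
  assumes g: "g meromorphic_on {0}" and "zorder g 0 > N"
  shows "lead N 0 g"
proof (cases "\<forall>\<^sub>F w in at 0. g w = 0")
  case True
  hence "\<forall>\<^sub>F w in at 0. 0 = g w / w powi N" by eventually_elim simp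
  thus ?thesis unfolding lead_def by (rule Lim_transform_eventually[OF tendsto_const])
next
  case False
  define n where "n = zorder g 0"
  have "isolated_singularity_at g 0" "not_essential g 0" "\<exists>\<^sub>F w in at 0. g w \<noteq> 0"
    using g False by (simp_all add: meromorphic_at_iff not_eventually)
  from zorder_exist[OF this, folded n_def] obtain r where
    r: "zor_poly g 0 0 \<noteq> 0" "zor_poly g 0 holomorphic_on cball 0 r" "r > 0"
       "\<And>w. w \<in> cball 0 r - {0} \<Longrightarrow> g w = zor_poly g 0 w * w powi n"
    by auto
  have "isCont (zor_poly g 0) 0"
    using holomorphic_on_subset[OF r(2) ball_subset_cball] r(3)
    by (intro continuous_on_interior[OF holomorphic_on_imp_continuous_on[OF r(2)]]) auto
  moreover have "\<forall>\<^sub>F w in at 0. zor_poly g 0 w = g w / w powi n"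
    using r(3,4) eventually_at[of "\<lambda>w. w \<in> cball 0 r - {0::complex}" 0 UNIV]
    by (intro eventually_at[THEN iffD2] exI[of _ r]) (auto simp: dist_commute)
  ultimately have "lead n (zor_poly g 0 0) g"
    unfolding lead_def isCont_def by (rule Lim_transform_eventually)
  thus ?thesis using lead_lower assms(2) n_def by blast
qed

text \<open>
  The Witt algebra relation \<open>z^K d/dz . z^N (dz)^(-1/2) = (N - K/2) z^(N+K-1) (dz)^(-1/2)\<close> at the
  level of leading coefficients.
\<close>
lemma lead_vf_act:
  assumes "e i meromorphic_on {0}" "\<phi> i meromorphic_on {0}" "lead K a (e i)" "lead N b (\<phi> i)"
  shows "lead (N + K - 1) ((of_int N - of_int K / 2) * a * b) (vf_act e \<phi> i)"
proof -
  have "lead (K + (N - 1)) (a * (of_int N * b)) (\<lambda>w. e i w * deriv (\<phi> i) w)"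
    using assms by (intro lead_mult lead_deriv)
  moreover have "lead (N + (K - 1)) (1/2 * b * (of_int K * a)) (\<lambda>w. 1/2 * \<phi> i w * deriv (e i) w)"
    using assms by (intro lead_mult lead_deriv lead_cmult)
  ultimately have "lead (N + K - 1) (a * (of_int N * b) - 1/2 * b * (of_int K * a)) (vf_act e \<phi> i)"
    unfolding vf_act_def by (intro lead_diff) (simp_all add: algebra_simps)
  thus ?thesis by (simp add: algebra_simps)
qed

section \<open>The filtration of sections by their order at the in-points\<close>

definition order_span :: "'a set \<Rightarrow> (int \<Rightarrow> 'a \<Rightarrow> 'i sect) \<Rightarrow> int \<Rightarrow> 'i sect set" where
  "order_span Ins g N = sect.span {g k p | k p. N \<le> k \<and> p \<in> Ins}"

lemma order_span_mono: "N \<le> M \<Longrightarrow> order_span Ins g M \<subseteq> order_span Ins g N"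
  unfolding order_span_def by (rule sect.span_mono) (blast intro: order.trans)

lemma subspace_order_span: "sect.subspace (order_span Ins g N)"
  unfolding order_span_def by (rule sect.subspace_span)

lemma order_span_base: "p \<in> Ins \<Longrightarrow> N \<le> k \<Longrightarrow> g k p \<in> order_span Ins g N"
  unfolding order_span_def by (rule sect.span_base) auto

text \<open>
  The hypothesis on \<open>g\<close> here and below is the normalisation of a Krichever--Novikov basis, reindexed
  by the order at the own in-point: the leading coefficients of \<open>g k p\<close> in order \<open>k\<close> form a Kronecker delta.
\<close>
lemma order_span_lead:
  assumes g: "\<And>k p q. p \<in> Ins \<Longrightarrow> q \<in> Ins \<Longrightarrow> lead k (if q = p then 1 else 0) (g k p (ch q))"
    and "s \<in> order_span Ins g N" "M < N" "q \<in> Ins"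
  shows "lead M 0 (s (ch q))"
  using assms(2) unfolding order_span_def
proof (induction rule: sect.span_induct_alt)
  case base
  show ?case by (simp add: zero_fun_def)
next
  case (step c x y)
  then obtain k p where "x = g k p" "N \<le> k" "p \<in> Ins" by auto
  hence "lead M 0 (x (ch q))" using lead_lower[OF g] assms(3,4) by auto
  from lead_add[OF lead_cmult[OF this, of c] step.IH] show ?case
    by (simp add: sect_scale_def plus_fun_def)
qed

lemma order_span_split:
  assumes "finite Ins" "s \<in> order_span Ins g N"
  shows "\<exists>a. \<exists>t \<in> order_span Ins g (N + 1). s = (\<Sum>p\<in>Ins. sect_scale (a p) (g N p)) + t"
  using assms(2) unfolding order_span_def[of _ _ N]
proof (induction rule: sect.span_induct_alt)
  case base
  show ?case
    by (rule exI[of _ "\<lambda>_. 0"], rule bexI[of _ 0])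
       (simp_all add: sect.subspace_0 subspace_order_span)
next
  case (step c x y)
  obtain k p where x: "x = g k p" "N \<le> k" "p \<in> Ins" using step.hyps by auto
  obtain a t where t: "t \<in> order_span Ins g (N + 1)"
      "y = (\<Sum>p\<in>Ins. sect_scale (a p) (g N p)) + t"
    using step.IH by blast
  show ?case
  proof (cases "k = N")
    case True
    have "sect_scale c (g N p) = (\<Sum>q\<in>Ins. sect_scale (if q = p then c else 0) (g N q))"
    proof -
      have "(\<Sum>q\<in>Ins. sect_scale (if q = p then c else 0) (g N q))
              = (\<Sum>q\<in>Ins. if q = p then sect_scale c (g N p) else 0)"
        by (rule sum.cong) auto
      also have "\<dots> = sect_scale c (g N p)" using x(3) assms(1) by (simp only: sum.delta if_True)
      finally show ?thesis by simp
    qed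
    hence "sect_scale c x + y =
            (\<Sum>q\<in>Ins. sect_scale ((if q = p then c else 0) + a q) (g N q)) + t"
      using True x t by (simp add: sect.scale_left_distrib sum.distrib add.assoc)
    thus ?thesis using t(1) by (intro exI bexI)
  next
    case False
    hence "x \<in> order_span Ins g (N + 1)" using x by (auto intro!: order_span_base)
    hence "sect_scale c x + t \<in> order_span Ins g (N + 1)"
      using t(1) subspace_order_span sect.subspace_add sect.subspace_scale by blast
    moreover have "sect_scale c x + y
        = (\<Sum>p\<in>Ins. sect_scale (a p) (g N p)) + (sect_scale c x + t)"
      using t by (simp add: algebra_simps)
    ultimately show ?thesis by (intro exI bexI)
  qed
qed

text \<open>
  Split off the part of order exactly \<open>N\<close>. Its coefficient at \<open>g N q\<close> is the leading coefficient of
  the whole section at \<open>q\<close>, hence zero.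
\<close>
lemma order_span_raise:
  assumes "finite Ins"
    and g: "\<And>k p q. p \<in> Ins \<Longrightarrow> q \<in> Ins \<Longrightarrow> lead k (if q = p then 1 else 0) (g k p (ch q))"
    and s: "s \<in> order_span Ins g N" and 0: "\<And>q. q \<in> Ins \<Longrightarrow> lead N 0 (s (ch q))"
  shows "s \<in> order_span Ins g (N + 1)"
proof -
  obtain a t where t: "t \<in> order_span Ins g (N + 1)"
      "s = (\<Sum>p\<in>Ins. sect_scale (a p) (g N p)) + t"
    using order_span_split[OF assms(1) s] by blast
  have "a q = 0" if q: "q \<in> Ins" for q
  proof -
    have sum: "lead N (\<Sum>p\<in>J. a p * (if q = p then 1 else 0))
            ((\<Sum>p\<in>J. sect_scale (a p) (g N p)) (ch q))" if "finite J" "J \<subseteq> Ins" for J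
      using that
    proof (induction J rule: finite_induct)
      case empty
      show ?case by (simp add: zero_fun_def)
    next
      case (insert p J)
      have "lead N (a p * (if q = p then 1 else 0) + (\<Sum>p\<in>J. a p * (if q = p then 1 else 0)))
              (\<lambda>w. a p * g N p (ch q) w + (\<Sum>p\<in>J. sect_scale (a p) (g N p)) (ch q) w)"
        using insert g q by (intro lead_add lead_cmult) auto
      thus ?case using insert.hyps by (simp add: plus_fun_def sect_scale_def)
    qed
    have "lead N 0 (t (ch q))" by (rule order_span_lead[OF g t(1) _ q]) auto
    from lead_add[OF sum[OF assms(1) order.refl] this]
    have "lead N (a q) (s (ch q))"
      using assms(1) q unfolding t(2) plus_fun_def by (simp add: if_distrib cong: if_cong)
    with 0[OF q] show ?thesis by (rule lead_unique[symmetric])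
  qed
  hence "s = t" using t(2) by simp
  thus ?thesis using t(1) by simp
qed

text \<open>
  A section lies in some step of the filtration since it is a finite combination of basis elements;
  it can then be raised one step at a time as long as its leading coefficients vanish.
\<close>
lemma in_order_spanI:
  assumes "finite Ins"
    and g: "\<And>k p q. p \<in> Ins \<Longrightarrow> q \<in> Ins \<Longrightarrow> lead k (if q = p then 1 else 0) (g k p (ch q))"
    and s: "s \<in> sect.span {g k p | k p. p \<in> Ins}" and 0: "\<And>q. q \<in> Ins \<Longrightarrow> lead N 0 (s (ch q))"
  shows "s \<in> order_span Ins g (N + 1)"
proof -
  have "\<exists>K. s \<in> order_span Ins g K"
    using s
  proof (induction rule: sect.span_induct_alt)
    case base
    have "0 \<in> order_span Ins g 0" by (intro sect.subspace_0 subspace_order_span)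
    thus ?case by (auto simp: zero_fun_def)
  next
    case (step c x y)
    then obtain K k p where *: "y \<in> order_span Ins g K" "x = g k p" "p \<in> Ins" by auto
    hence "x \<in> order_span Ins g (min k K)" "y \<in> order_span Ins g (min k K)"
      using order_span_mono[of "min k K" K Ins g] order_span_base[of p Ins "min k K" k g] by auto
    thus ?case using subspace_order_span sect.subspace_add sect.subspace_scale by blast
  qed
  then obtain K where K: "s \<in> order_span Ins g K" ..
  have *: "s \<in> order_span Ins g (K + int j)" if "K + int j \<le> N + 1" for j
    using that
  proof (induction j)
    case 0
    thus ?case using K by simp
  next
    case (Suc j)
    have "s \<in> order_span Ins g (K + int j + 1)"
    proof (rule order_span_raise[where ch = ch, OF assms(1) g])
      show "lead (K + int j) 0 (s (ch q))" if "q \<in> Ins" for q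
        using lead_lower[OF 0[OF that], of "K + int j"] 0[OF that] Suc.prems
        by (cases "K + int j = N") auto
    qed (use Suc in auto)
    thus ?case by (simp add: algebra_simps)
  qed
  show ?thesis
  proof (cases "K \<le> N + 1")
    case True
    with *[of "nat (N + 1 - K)"] show ?thesis by simp
  next
    case False
    with K order_span_mono[of "N + 1" K Ins g] show ?thesis by auto
  qed
qed

section \<open>Invariant forms bounded from above vanish\<close>

text \<open>
  The abstract situation of the descent: \<open>V\<close> is the space of \<open>(-1/2)\<close>-forms, \<open>\<phi>\<close> and \<open>e\<close> are the
  Krichever--Novikov bases of forms and of vector fields indexed by order, and \<open>b\<close> is the restriction
  of the cocycle to pairs of odd elements.
\<close>
locale invariant_odd_form =
  fixes Ins :: "'a set" and ch :: "'a \<Rightarrow> 'i" and V :: "'i sect set"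
    and \<phi> e :: "int \<Rightarrow> 'a \<Rightarrow> 'i sect" and b :: "'i sect \<Rightarrow> 'i sect \<Rightarrow> complex"
  assumes fin: "finite Ins"
    and V_span: "V = sect.span {\<phi> N p | N p. p \<in> Ins}"
    and lead_\<phi>: "\<And>N p q. p \<in> Ins \<Longrightarrow> q \<in> Ins \<Longrightarrow> lead N (if q = p then 1 else 0) (\<phi> N p (ch q))"
    and lead_e: "\<And>K p q. p \<in> Ins \<Longrightarrow> q \<in> Ins \<Longrightarrow> lead K (if q = p then 1 else 0) (e K p (ch q))"
    and mero_\<phi>: "\<And>N p q. p \<in> Ins \<Longrightarrow> q \<in> Ins \<Longrightarrow> \<phi> N p (ch q) meromorphic_on {0}"
    and mero_e: "\<And>K p q. p \<in> Ins \<Longrightarrow> q \<in> Ins \<Longrightarrow> e K p (ch q) meromorphic_on {0}"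
    and act: "\<And>K p x. p \<in> Ins \<Longrightarrow> x \<in> V \<Longrightarrow> vf_act (e K p) x \<in> V"
    and b_add: "\<And>x y z. x \<in> V \<Longrightarrow> y \<in> V \<Longrightarrow> z \<in> V \<Longrightarrow> b (x + y) z = b x z + b y z"
    and b_scale: "\<And>a x z. x \<in> V \<Longrightarrow> z \<in> V \<Longrightarrow> b (sect_scale a x) z = a * b x z"
    and b_sym: "\<And>x y. x \<in> V \<Longrightarrow> y \<in> V \<Longrightarrow> b x y = b y x"
    and b_inv: "\<And>K p x y. p \<in> Ins \<Longrightarrow> x \<in> V \<Longrightarrow> y \<in> V \<Longrightarrow>
                  b (vf_act (e K p) x) y + b x (vf_act (e K p) y) = 0"
begin

definition vanishes_from :: "int \<Rightarrow> bool" where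
  "vanishes_from s \<longleftrightarrow>
     (\<forall>N M. \<forall>p \<in> Ins. \<forall>r \<in> Ins. s \<le> N + M \<longrightarrow> b (\<phi> N p) (\<phi> M r) = 0)"

lemma subspace_V: "sect.subspace V" unfolding V_span by (rule sect.subspace_span)

lemma phi_V: "p \<in> Ins \<Longrightarrow> \<phi> N p \<in> V"
  unfolding V_span by (rule sect.span_base) auto

lemma order_span_V: "order_span Ins \<phi> N \<subseteq> V"
  unfolding V_span order_span_def by (rule sect.span_mono) auto

lemma span_vanish:
  assumes "A \<subseteq> V" "z \<in> V" "\<And>x. x \<in> A \<Longrightarrow> b x z = 0" "x \<in> sect.span A"
  shows "b x z = 0"
proof -
  have "x \<in> V \<and> b x z = 0"
    using assms(4)
  proof (induction rule: sect.span_induct_alt)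
    case base
    have "b 0 z = 0" using b_scale[of 0 z 0] sect.subspace_0[OF subspace_V] assms(2) by simp
    thus ?case using sect.subspace_0[OF subspace_V] by (simp add: zero_fun_def)
  next
    case (step c x y)
    hence "x \<in> V" "y \<in> V" "b x z = 0" "b y z = 0" using assms by auto
    hence "sect_scale c x + y \<in> V \<and> b (sect_scale c x + y) z = 0"
      using assms(2) by (simp add: b_add b_scale sect.subspace_add sect.subspace_scale subspace_V)
    thus ?case by (simp add: plus_fun_def)
  qed
  thus ?thesis ..
qed

lemma vanishes_from_order_span:
  assumes "vanishes_from s" "x \<in> order_span Ins \<phi> N" "q \<in> Ins" "s \<le> N + M"
  shows "b x (\<phi> M q) = 0"
  using assms by (intro span_vanish[OF _ _ _ assms(2)[unfolded order_span_def]])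
    (auto simp: phi_V vanishes_from_def)

text \<open>
  The subtracted term cancels the leading coefficients in order \<open>N + K - 1\<close> at all in-points: at \<open>p\<close>
  by the choice of its factor, at the others because both sides have none.
\<close>
lemma act_basis:
  assumes "p \<in> Ins" "r \<in> Ins"
  shows "vf_act (e K p) (\<phi> N r) - sect_scale (if p = r then of_int N - of_int K / 2 else 0) (\<phi> (N + K - 1) p)
           \<in> order_span Ins \<phi> (N + K)"
proof -
  let ?k = "if p = r then of_int N - of_int K / 2 else (0::complex)"
  let ?d = "vf_act (e K p) (\<phi> N r) - sect_scale ?k (\<phi> (N + K - 1) p)"
  have "?d \<in> V"
    using assms by (intro sect.subspace_diff sect.subspace_scale subspace_V act phi_V)
  moreover have "lead (N + K - 1) 0 (?d (ch q))" if q: "q \<in> Ins" for q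
  proof -
    have "lead (N + K - 1) ((of_int N - of_int K / 2) * (if q = p then 1 else 0) * (if q = r then 1 else 0)
             - ?k * (if q = p then 1 else 0))
            (\<lambda>w. vf_act (e K p) (\<phi> N r) (ch q) w - ?k * \<phi> (N + K - 1) p (ch q) w)"
      using assms q by (intro lead_diff lead_vf_act lead_cmult lead_e lead_\<phi> mero_e mero_\<phi>)
    moreover have "(of_int N - of_int K / 2) * (if q = p then 1 else 0) * (if q = r then 1 else 0)
             - ?k * (if q = p then 1 else 0) = (0::complex)" by auto
    ultimately show ?thesis by (simp add: fun_diff_def sect_scale_def)
  qed
  ultimately have "?d \<in> order_span Ins \<phi> (N + K - 1 + 1)"
    by (intro in_order_spanI[of _ _ ch] fin) (auto simp: lead_\<phi> V_span)
  thus ?thesis by simp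
qed

lemma act_top_level:
  assumes "vanishes_from (s + 1)" "p \<in> Ins" "r \<in> Ins" "q \<in> Ins" "N + M + K - 1 = s"
  shows "b (vf_act (e K p) (\<phi> N r)) (\<phi> M q)
           = (if p = r then of_int N - of_int K / 2 else 0) * b (\<phi> (N + K - 1) p) (\<phi> M q)"
proof -
  let ?k = "if p = r then of_int N - of_int K / 2 else (0::complex)"
  let ?d = "vf_act (e K p) (\<phi> N r) - sect_scale ?k (\<phi> (N + K - 1) p)"
  have d: "?d \<in> order_span Ins \<phi> (N + K)"
    using assms by (intro act_basis)
  have "b ?d (\<phi> M q) = 0"
    using assms by (intro vanishes_from_order_span[OF assms(1) d]) auto
  moreover have "b (?d + sect_scale ?k (\<phi> (N + K - 1) p)) (\<phi> M q)
      = b ?d (\<phi> M q) + ?k * b (\<phi> (N + K - 1) p) (\<phi> M q)"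
    using assms subsetD[OF order_span_V d]
    by (subst b_add) (simp_all only: b_scale phi_V sect.subspace_scale[OF subspace_V])
  ultimately show ?thesis by simp
qed

text \<open>
  Invariance under \<open>e K p\<close>, reduced to the lowest-order terms. This is where the induction over the
  level gets its linear relations.
\<close>
lemma top_level_relation:
  assumes "vanishes_from (s + 1)" "p \<in> Ins" "r \<in> Ins" "q \<in> Ins" "N + M + K - 1 = s"
  shows "(if p = r then of_int N - of_int K / 2 else 0) * b (\<phi> (N + K - 1) p) (\<phi> M q)
       + (if p = q then of_int M - of_int K / 2 else 0) * b (\<phi> N r) (\<phi> (M + K - 1) p) = 0"
proof -
  have "b (\<phi> N r) (vf_act (e K p) (\<phi> M q)) = b (vf_act (e K p) (\<phi> M q)) (\<phi> N r)"
    using assms by (intro b_sym act phi_V)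
  also have "\<dots> = (if p = q then of_int M - of_int K / 2 else 0) * b (\<phi> N r) (\<phi> (M + K - 1) p)"
    using assms by (subst act_top_level[of s]) (auto simp: phi_V b_sym)
  finally show ?thesis
    using b_inv[of p "\<phi> N r" "\<phi> M q" K] act_top_level[OF assms] assms by (simp add: phi_V)
qed

lemma vanishes_from_step:
  assumes "vanishes_from (s + 1)"
  shows "vanishes_from s"
proof -
  have "b (\<phi> N p) (\<phi> M q) = 0" if pq: "p \<in> Ins" "q \<in> Ins" and s: "N + M = s" for N M p q
  proof -
    have half: "of_int N * 2 \<noteq> (1::complex)" for N
    proof
      assume "of_int N * 2 = (1::complex)"
      hence "of_int (N * 2) = (of_int 1 :: complex)" by simp
      hence "N * 2 = 1" by (simp only: of_int_eq_iff)
      thus False by presburger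
    qed
    \<comment> \<open>\<open>e 1 p\<close> is an Euler field at \<open>p\<close>: it preserves the level, so every pair \<open>N + M = s\<close> is reached.\<close>
    have rel: "(of_int N - 1 / 2) * b (\<phi> N p) (\<phi> M q)
       + (if p = q then of_int M - 1 / 2 else 0) * b (\<phi> N p) (\<phi> M p) = 0"
      using top_level_relation[OF assms pq(1) pq(1) pq(2), of N M 1] s
      by (cases "p = q") simp_all
    show ?thesis
    proof (cases "p = q \<and> N + M = 1")
      case False
      show ?thesis
      proof (cases "p = q")
        case True
        with rel have "(of_int (N + M - 1)) * b (\<phi> N p) (\<phi> M p) = 0"
          by (simp add: algebra_simps)
        moreover have "of_int (N + M - 1) \<noteq> (0::complex)"
          using False True unfolding of_int_eq_0_iff by simp
        ultimately show ?thesis using True by simp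
      next
        case False
        thus ?thesis using rel half[of N] by simp
      qed
    next
      case True
      hence M: "M = 1 - N" by simp
      \<comment> \<open>The Euler field gives \<open>0 = 0\<close> here. The order \<open>2 - 2 * N\<close> is the one that moves \<open>\<phi> N p\<close> to
        \<open>\<phi> (1 - N) p\<close>; by symmetry of \<open>b\<close> the two terms of the relation coincide.\<close>
      have "(of_int N - of_int (2 - 2 * N) / 2) * b (\<phi> M p) (\<phi> N p)
          + (of_int N - of_int (2 - 2 * N) / 2) * b (\<phi> N p) (\<phi> M p) = 0"
        using top_level_relation[OF assms pq(1) pq(1) pq(1), of N N "2 - 2 * N"] s
        by (simp add: M)
      hence "(of_int N - 1 / 2) * b (\<phi> N p) (\<phi> M p) = 0"
        using b_sym[of "\<phi> M p" "\<phi> N p"] pq by (simp add: phi_V field_simps)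
      thus ?thesis using half True by simp
    qed
  qed
  thus ?thesis
    using assms unfolding vanishes_from_def by (metis order_le_less zless_imp_add1_zle)
qed

lemma bounded_imp_zero:
  assumes "vanishes_from s" "x \<in> V" "y \<in> V"
  shows "b x y = 0"
proof -
  have le: "vanishes_from t" if "t \<le> s" for t
    using that
  proof (induction rule: int_le_induct)
    case (step t)
    thus ?case using vanishes_from_step[of "t - 1"] by simp
  qed (rule assms(1))
  have basis: "b (\<phi> N p) (\<phi> M q) = 0" if "p \<in> Ins" "q \<in> Ins" for N M p q
    using le[of "min s (N + M)"] that by (auto simp: vanishes_from_def)
  have *: "b x (\<phi> M q) = 0" if "q \<in> Ins" "x \<in> V" for x M q
    using that(2)[unfolded V_span]
    by (rule span_vanish[rotated -1]) (use that basis in \<open>auto simp: phi_V\<close>)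
  \<comment> \<open>\<open>b\<close> is only assumed linear on the left, so linearity on the right comes from symmetry.\<close>
  have "b y x = 0"
    using assms(3)[unfolded V_span]
    by (rule span_vanish[rotated -1]) (use * assms b_sym in \<open>auto simp: phi_V\<close>)
  thus ?thesis using b_sym assms by simp
qed

end


section \<open>Sections of powers of the theta characteristic\<close>

lemma chart_inv_map:
  assumes "riemann_surface X" "x \<in> chart_dom X i"
  shows "chart_inv X i (chart_map X i x) = x"
proof -
  have "inj_on (chart_map X i) (chart_dom X i)"
    using assms(1) unfolding riemann_surface_def by blast
  thus ?thesis
    using assms(2) unfolding chart_inv_def by (rule the_inv_into_f_f)
qed

lemma open_chart_map_image:
  assumes "riemann_surface X" "open U" "U \<subseteq> chart_dom X i"
  shows "open (chart_map X i ` U)"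
proof -
  have hom: "homeomorphism (chart_dom X i) (chart_image X i) (chart_map X i) (chart_inv X i)"
    and op: "open (chart_image X i)"
    using assms(1) by (auto simp: riemann_surface_def)
  have "openin (top_of_set (chart_dom X i)) U"
    using assms(2,3) by (simp add: openin_open_eq open_subset)
  from homeomorphism_imp_open_map[OF hom this] op show ?thesis
    by (rule openin_open_trans)
qed

lemma FF_meromorphic: "s \<in> FF X L A lam \<Longrightarrow> s i meromorphic_on chart_image X i"
  unfolding FF_def mero_sections_def by blast

lemma FF_holomorphic: "s \<in> FF X L A lam \<Longrightarrow> s i holomorphic_on chart_map X i ` (chart_dom X i - A)"
  unfolding FF_def mero_sections_def by blast

lemma FF_outside: "s \<in> FF X L A lam \<Longrightarrow> w \<notin> chart_map X i ` (chart_dom X i - A) \<Longrightarrow> s i w = 0"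
  unfolding FF_def mero_sections_def by blast

lemma FF_subset_meromorphic:
  assumes "s \<in> FF X L A lam" "q \<in> chart_dom X i"
  shows "s i meromorphic_on {chart_map X i q}"
  by (rule meromorphic_on_subset[OF FF_meromorphic[OF assms(1)]])
     (use assms(2) in \<open>auto simp: chart_image_def\<close>)

lemma FF_transition:
  assumes "s \<in> FF X L A lam" "x \<in> chart_dom X i \<inter> chart_dom X j - A"
  shows "s i (chart_map X i x) = L i j x powi \<lfloor>2 * lam\<rfloor> * s j (chart_map X j x)"
  using assms unfolding FF_def mero_sections_def bundle_power_def by blast

lemma floor_minus_one_real: "\<lfloor>- 1 :: real\<rfloor> = - 1"
  by (rule floor_unique) simp_all

lemma sect_mult_FF:
  assumes "s \<in> FF X L A (-1/2)" "t \<in> FF X L A (-1/2)"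
  shows "sect_mult s t \<in> FF X L A (-1)"
proof -
  note s = FF_meromorphic[OF assms(1)] FF_holomorphic[OF assms(1)]
  note t = FF_meromorphic[OF assms(2)] FF_holomorphic[OF assms(2)]
  show ?thesis
    unfolding FF_def mero_sections_def mem_Collect_eq
  proof (intro conjI allI impI ballI)
    fix i
    show "sect_mult s t i meromorphic_on chart_image X i"
      unfolding sect_mult_def by (intro meromorphic_intros s t)
    show "sect_mult s t i holomorphic_on chart_map X i ` (chart_dom X i - A)"
      unfolding sect_mult_def by (intro holomorphic_intros s t)
  next
    fix i w assume "w \<notin> chart_map X i ` (chart_dom X i - A)"
    thus "sect_mult s t i w = 0"
      by (simp add: sect_mult_def FF_outside[OF assms(1)])
  next
    fix i j x assume x: "x \<in> chart_dom X i \<inter> chart_dom X j - A"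
    have "s i (chart_map X i x) = inverse (L i j x) * s j (chart_map X j x)"
         "t i (chart_map X i x) = inverse (L i j x) * t j (chart_map X j x)"
      using FF_transition[OF assms(1) x] FF_transition[OF assms(2) x] floor_minus_one_real
      by simp_all
    thus "sect_mult s t i (chart_map X i x) = bundle_power L (- 1) i j x * sect_mult s t j (chart_map X j x)"
      by (simp add: sect_mult_def bundle_power_def power_int_minus power2_eq_square)
  qed
qed

text \<open>
  The chain rule computation behind the invariance of \<open>e.\<phi>\<close> under a change of coordinate \<open>\<tau>\<close> with
  \<open>\<tau>' = g^2\<close>: the two terms containing \<open>g'\<close> cancel exactly because of the factor \<open>1/2\<close> in the
  action.
\<close>
lemma vf_act_transition:
  fixes g \<tau> p e :: "complex \<Rightarrow> complex"
  assumes U: "open U" "z \<in> U"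
    and \<tau>: "(\<tau> has_field_derivative g z ^ 2) (at z)"
    and g: "(g has_field_derivative g') (at z)" "g z \<noteq> 0"
    and p: "(p has_field_derivative p') (at (\<tau> z))" "\<And>w. w \<in> U \<Longrightarrow> P w = p (\<tau> w) / g w"
    and e: "(e has_field_derivative e') (at (\<tau> z))" "\<And>w. w \<in> U \<Longrightarrow> E w = e (\<tau> w) / g w ^ 2"
  shows "E z * deriv P z - 1/2 * P z * deriv E z
           = (e (\<tau> z) * p' - 1/2 * p (\<tau> z) * e') / g z"
proof -
  define I where "I = inverse (g z)"
  have I: "I * (I * g z) = I" using g(2) by (simp add: I_def)
  have g_inv: "((\<lambda>w. inverse (g w)) has_field_derivative - (I * g' * I)) (at z)"
    unfolding I_def by (rule DERIV_inverse'[OF g(1) g(2)])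
  have g_inv2: "((\<lambda>w. inverse (g w) ^ 2) has_field_derivative - (2 * I * (I * g' * I))) (at z)"
    by (auto intro!: derivative_eq_intros g simp: I_def)
  have "((\<lambda>w. p (\<tau> w) * inverse (g w)) has_field_derivative
          p' * g z ^ 2 * I + - (I * g' * I) * p (\<tau> z)) (at z)"
    unfolding I_def using DERIV_mult[OF DERIV_chain2[where f = p and g = \<tau>, OF p(1) \<tau>] g_inv]
    by (simp add: I_def)
  hence "(P has_field_derivative p' * g z ^ 2 * I + - (I * g' * I) * p (\<tau> z)) (at z)"
    by (rule has_field_derivative_transform_within_open[OF _ U]) (simp add: p(2) divide_inverse)
  hence P': "deriv P z = p' * g z ^ 2 * I + - (I * g' * I) * p (\<tau> z)"
    by (rule DERIV_imp_deriv)
  have "((\<lambda>w. e (\<tau> w) * inverse (g w) ^ 2) has_field_derivative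
          e' * g z ^ 2 * I ^ 2 + - (2 * I * (I * g' * I)) * e (\<tau> z)) (at z)"
    using DERIV_mult[OF DERIV_chain2[where f = e and g = \<tau>, OF e(1) \<tau>] g_inv2]
    by (simp add: I_def)
  hence "(E has_field_derivative
          e' * g z ^ 2 * I ^ 2 + - (2 * I * (I * g' * I)) * e (\<tau> z)) (at z)"
    by (rule has_field_derivative_transform_within_open[OF _ U])
       (simp add: e(2) divide_inverse power_inverse)
  hence E': "deriv E z = e' * g z ^ 2 * I ^ 2 + - (2 * I * (I * g' * I)) * e (\<tau> z)"
    by (rule DERIV_imp_deriv)
  have gI: "g z ^ 2 * I ^ 2 = 1" "g z ^ 2 * I = g z"
    using g(2) by (simp_all add: I_def field_simps power2_eq_square)
  have P: "P z = p (\<tau> z) * I" and E: "E z = e (\<tau> z) * I ^ 2"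
    using p(2)[OF U(2)] e(2)[OF U(2)] by (simp_all add: I_def divide_inverse power_inverse)
  have P'': "deriv P z = p' * g z - I ^ 2 * g' * p (\<tau> z)"
    unfolding P' mult.assoc gI by (simp add: power2_eq_square)
  have E'': "deriv E z = e' - 2 * I ^ 3 * g' * e (\<tau> z)"
    unfolding E' mult.assoc[of e'] gI by (simp add: power3_eq_cube)
  have "E z * deriv P z - 1/2 * P z * deriv E z
      = e (\<tau> z) * p' * (I * (I * g z)) - 1/2 * p (\<tau> z) * e' * I"
    unfolding P E P'' E'' by (simp add: right_diff_distrib power2_eq_square power3_eq_cube)
  thus ?thesis unfolding I by (simp add: I_def divide_inverse[of _ "g z"] left_diff_distrib)
qed

lemma vf_act_FF:
  assumes X: "riemann_surface X" and L: "theta_characteristic X L" and A: "finite A"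
    and e: "e \<in> FF X L A (-1)" and p: "p \<in> FF X L A (-1/2)"
  shows "vf_act e p \<in> FF X L A (-1/2)"
proof -
  have op: "open (chart_dom X i - A)" for i
    using X A by (auto simp: riemann_surface_def intro!: open_Diff finite_imp_closed)
  have op_img: "open (chart_map X i ` (chart_dom X i - A))" for i
    by (rule open_chart_map_image[OF X op]) auto
  have e_trans: "e i (chart_map X i x) = e j (chart_map X j x) / L i j x ^ 2"
    and p_trans: "p i (chart_map X i x) = p j (chart_map X j x) / L i j x"
    if "x \<in> chart_dom X i \<inter> chart_dom X j - A" for i j x
    using FF_transition[OF e that] FF_transition[OF p that] floor_minus_one_real
    by (simp_all add: power_int_minus divide_inverse[of _ "L i j x"] divide_inverse[of _ "L i j x ^ 2"] mult.commute)
  note e_hol = FF_holomorphic[OF e] and p_hol = FF_holomorphic[OF p]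
  have trans: "vf_act e p i (chart_map X i x) = vf_act e p j (chart_map X j x) / L i j x"
    if x: "x \<in> chart_dom X i \<inter> chart_dom X j - A" for i j x
  proof -
    let ?\<tau> = "chart_map X j \<circ> chart_inv X i" and ?g = "L i j \<circ> chart_inv X i"
    let ?W = "chart_dom X i \<inter> chart_dom X j" and ?z = "chart_map X i x"
    have W: "open (?W - A)" "open ?W"
      using X A by (auto simp: riemann_surface_def intro!: open_Diff finite_imp_closed)
    have openW: "open (chart_map X i ` ?W)" "open (chart_map X i ` (?W - A))"
      by (rule open_chart_map_image[OF X]; use W in blast)+
    have inv: "chart_inv X i (chart_map X i y) = y" if "y \<in> ?W" for y
      using chart_inv_map[OF X] that by blast
    have \<tau>z: "?\<tau> ?z = chart_map X j x" and gz: "?g ?z = L i j x"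
      using inv x by auto
    have "?\<tau> holomorphic_on chart_map X i ` ?W"
      using X unfolding riemann_surface_def by blast
    hence "(?\<tau> has_field_derivative deriv ?\<tau> ?z) (at ?z)"
      using openW(1) x by (intro holomorphic_derivI) auto
    moreover have "deriv ?\<tau> ?z = ?g ?z ^ 2"
      using L x unfolding theta_characteristic_def canonical_bundle_def gz by fastforce
    ultimately have \<tau>': "(?\<tau> has_field_derivative ?g ?z ^ 2) (at ?z)" by simp
    have "?g holomorphic_on chart_map X i ` ?W"
      using L unfolding theta_characteristic_def line_bundle_def by blast
    hence g': "(?g has_field_derivative deriv ?g ?z) (at ?z)"
      using openW(1) x by (intro holomorphic_derivI) auto
    have g0: "?g ?z \<noteq> 0"
      using L x unfolding theta_characteristic_def line_bundle_def gz by blast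
    have ej: "(e j has_field_derivative deriv (e j) (?\<tau> ?z)) (at (?\<tau> ?z))"
      unfolding \<tau>z using x by (intro holomorphic_derivI[OF e_hol op_img]) auto
    have pj: "(p j has_field_derivative deriv (p j) (?\<tau> ?z)) (at (?\<tau> ?z))"
      unfolding \<tau>z using x by (intro holomorphic_derivI[OF p_hol op_img]) auto
    have "e i ?z * deriv (p i) ?z - 1/2 * p i ?z * deriv (e i) ?z
        = (e j (?\<tau> ?z) * deriv (p j) (?\<tau> ?z) - 1/2 * p j (?\<tau> ?z) * deriv (e j) (?\<tau> ?z)) / ?g ?z"
    proof (rule vf_act_transition[OF openW(2) _ \<tau>' g' g0 pj _ ej])
      show "?z \<in> chart_map X i ` (?W - A)" using x by blast
    next
      fix w assume "w \<in> chart_map X i ` (?W - A)"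
      then obtain y where y: "y \<in> ?W - A" "w = chart_map X i y" by blast
      show "p i w = p j (?\<tau> w) / ?g w" "e i w = e j (?\<tau> w) / ?g w ^ 2"
        using p_trans[OF y(1)] e_trans[OF y(1)] y inv by auto
    qed
    thus ?thesis unfolding vf_act_def \<tau>z gz .
  qed
  show ?thesis
    unfolding FF_def mero_sections_def mem_Collect_eq
  proof (intro conjI allI impI ballI)
    fix i
    show "vf_act e p i meromorphic_on chart_image X i"
      unfolding vf_act_def by (intro meromorphic_intros FF_meromorphic[OF e] FF_meromorphic[OF p])
    show "vf_act e p i holomorphic_on chart_map X i ` (chart_dom X i - A)"
      unfolding vf_act_def by (intro holomorphic_intros e_hol p_hol op_img)
  next
    fix i w assume "w \<notin> chart_map X i ` (chart_dom X i - A)"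
    thus "vf_act e p i w = 0"
      by (simp add: vf_act_def FF_outside[OF e] FF_outside[OF p])
  next
    fix i j x assume "x \<in> chart_dom X i \<inter> chart_dom X j - A"
    from trans[OF this] show "vf_act e p i (chart_map X i x)
        = bundle_power L (- 1 / 2) i j x * vf_act e p j (chart_map X j x)"
      using floor_minus_one_real by (simp add: bundle_power_def divide_inverse[of _ "L i j x"] mult.commute)
  qed
qed

section \<open>Krichever--Novikov bases indexed by order\<close>

lemma kn_basis_subspace: "kn_basis X L Ins A lam b \<Longrightarrow> sect.subspace (FF X L A lam)"
  unfolding kn_basis_def by (metis sect.subspace_span)

text \<open>
  For \<open>n \<in> JJ lam\<close> the integer \<open>N = n - lam\<close> is the order of the basis element at its own in-point;
  indexing by \<open>N\<close> makes integral and half-integral weights uniform.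
\<close>
lemma kn_basis_span:
  assumes "kn_basis X L Ins A lam b"
  shows "FF X L A lam = sect.span {b (of_int N + lam) p | N p. p \<in> Ins}"
proof -
  have "(\<lambda>(n, p). b n p) ` (JJ lam \<times> Ins) = {b (of_int N + lam) p | N p. p \<in> Ins}"
  proof (intro equalityI subsetI)
    fix s assume "s \<in> (\<lambda>(n, p). b n p) ` (JJ lam \<times> Ins)"
    then obtain n p where s: "s = b n p" "n - lam \<in> \<int>" "p \<in> Ins" by (auto simp: JJ_def)
    then obtain N where "n - lam = of_int N" by (auto elim: Ints_cases)
    hence "n = of_int N + lam" by simp
    thus "s \<in> {b (of_int N + lam) p | N p. p \<in> Ins}" using s by blast
  qed (force simp: JJ_def)
  thus ?thesis using assms unfolding kn_basis_def by simp
qed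

text \<open>
  At the own in-point the coefficient comes from the normalisation \<open>z^N (1 + O(z))\<close>, at the others
  from the order bound, which exceeds \<open>N\<close> by one there.
\<close>
lemma kn_bases_lead:
  assumes "kn_bases X L Ins Outs ch C f" "lam \<in> {-1, -1/2, 3/2, 2}"
    and ch: "\<forall>p \<in> Ins. p \<in> chart_dom X (ch p) \<and> chart_map X (ch p) p = 0"
    and pq: "p \<in> Ins" "q \<in> Ins"
  shows "f lam (of_int N + lam) p (ch q) meromorphic_on {0}" (is ?mero)
    and "lead N (if q = p then 1 else 0) (f lam (of_int N + lam) p (ch q))"
proof -
  let ?n = "of_int N + lam"
  have basis: "kn_basis X L Ins (Ins \<union> Outs) lam (f lam)"
    using assms(1,2) unfolding kn_bases_def by blast
  have n: "?n \<in> JJ lam" by (simp add: JJ_def)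
  have "f lam ?n p \<in> FF X L (Ins \<union> Outs) lam"
    unfolding kn_basis_span[OF basis] using pq by (intro sect.span_base) blast
  from FF_subset_meromorphic[OF this, of q "ch q"] show mero: ?mero
    using ch pq by auto
  have lim: "(\<lambda>w. f lam ?n p (ch p) w / w powi \<lfloor>?n - lam\<rfloor> - 1) \<in> O[at 0](\<lambda>w. w)"
    and ord: "ord_ge X (f lam ?n p) q ((?n + 1 - lam) - (if q = p then 1 else 0))"
    using assms(1,2) n pq unfolding kn_bases_def by blast+
  show "lead N (if q = p then 1 else 0) (f lam ?n p (ch q))"
  proof (cases "q = p")
    case True
    have "((\<lambda>w. f lam ?n p (ch p) w / w powi N - 1) \<longlongrightarrow> 0) (at 0)"
    proof -
      have "(\<lambda>w. f lam ?n p (ch p) w / w powi N - 1) \<in> O[at 0](\<lambda>w. w)" using lim by simp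
      also have "(\<lambda>w::complex. w) \<in> o[at 0](\<lambda>w. 1)"
        by (intro smalloI_tendsto) (auto intro: tendsto_eq_intros)
      finally show ?thesis by (auto dest: smalloD_tendsto)
    qed
    from tendsto_add[OF this tendsto_const[of 1]] show ?thesis
      using True by (simp add: lead_def)
  next
    case False
    hence "of_int (N + 1) \<le> real_of_int (zorder (f lam ?n p (ch q)) 0)"
      using ord ch pq unfolding ord_ge_def by auto
    hence "zorder (f lam ?n p (ch q)) 0 > N" by linarith
    with mero False show ?thesis by (simp add: lead_zorder)
  qed
qed

section \<open>Cocycles\<close>

text \<open>
  The cocycle identity for \<open>e\<close>, \<open>x\<close>, \<open>y\<close> reads \<open>c e [x, y] + c x [y, e] - c y [e, x] = 0\<close>. Its
  first term is the one assumed to vanish, \<open>[y, e] = - e.y\<close>, and \<open>c\<close> is symmetric on odd elements.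
\<close>
lemma even_super_cocycle_invariant:
  assumes c: "even_super_cocycle X L A c"
    and e: "e \<in> FF X L A (-1)" and xy: "x \<in> FF X L A (-1/2)" "y \<in> FF X L A (-1/2)"
    and zero_FF: "0 \<in> FF X L A (-1)"
    and act: "vf_act e x \<in> FF X L A (-1/2)" "vf_act e y \<in> FF X L A (-1/2)"
    and 0: "c (e, 0) (sect_mult x y, 0) = 0"
  shows "c (0, vf_act e x) (0, y) + c (0, x) (0, vf_act e y) = 0"
proof -
  have deriv0: "deriv (0 :: complex \<Rightarrow> complex) = 0"
    by (simp add: zero_fun_def fun_eq_iff)
  have m: "(e, 0) \<in> SS_par X L A 0" "(0, x) \<in> SS_par X L A 1" "(0, y) \<in> SS_par X L A 1"
    "(0, vf_act e x) \<in> SS_par X L A 1"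
    using e xy act by (auto simp: SS_par_def)
  have br: "super_bracket (0, x) (0, y) = (sect_mult x y, 0)"
     "super_bracket (0, y) (e, 0) = (0, - vf_act e y)"
     "super_bracket (e, 0) (0, x) = (0, vf_act e x)"
    by (simp_all add: super_bracket_def vf_bracket_def vf_act_def sect_mult_def fun_eq_iff deriv0)
  have neg: "(0, - vf_act e y) = super_scale (-1) (0, vf_act e y)"
    by (simp add: super_scale_def sect_scale_def fun_eq_iff)
  have bil: "bilinear_on_SS X L A c" using c by (simp add: even_super_cocycle_def)
  have SS: "(0, x) \<in> SS X L A" "(0, vf_act e y) \<in> SS X L A"
    using xy act zero_FF by (auto simp: SS_def)
  have "c (0, x) (0, - vf_act e y) = - c (0, x) (0, vf_act e y)"
    using bil SS unfolding neg bilinear_on_SS_def by fastforce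
  moreover have "(-1) ^ (0 * 1) * c (e, 0) (super_bracket (0, x) (0, y))
        + (-1) ^ (1 * 0) * c (0, x) (super_bracket (0, y) (e, 0))
        + (-1) ^ (1 * 1) * c (0, y) (super_bracket (e, 0) (0, x)) = 0"
    using c m unfolding even_super_cocycle_def by blast
  moreover have "c (0, y) (0, vf_act e x) = - ((-1) ^ (1 * 1) * c (0, vf_act e x) (0, y))"
    using c m unfolding even_super_cocycle_def by blast
  ultimately have "- c (0, x) (0, vf_act e y) = c (0, vf_act e x) (0, y)"
    using 0 by (simp add: br)
  thus ?thesis by (metis left_minus)
qed

text \<open>
  Boundedness provides the starting level of the descent for the odd-odd part of \<open>c\<close>; bilinearity and
  parity reduce \<open>c\<close> to this part.
\<close>
lemma bounded_cocycle_zero: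
  fixes X :: "('a::t2_space, 'i) atlas"
  assumes X: "riemann_surface X" and L: "theta_characteristic X L"
    and A: "finite A" "A = Ins \<union> Outs"
    and ch: "\<forall>p \<in> Ins. p \<in> chart_dom X (ch p) \<and> chart_map X (ch p) p = 0"
    and kn: "kn_bases X L Ins Outs ch C f"
    and c: "even_super_cocycle X L A c" and bd: "bounded_above Ins f c"
    and 0: "\<And>e g. e \<in> FF X L A (-1) \<Longrightarrow> g \<in> FF X L A (-1) \<Longrightarrow> c (e, 0) (g, 0) = 0"
    and x: "x \<in> SS X L A" and y: "y \<in> SS X L A"
  shows "c x y = 0"
proof -
  define \<phi> e where "\<phi> = (\<lambda>N::int. f (-1/2) (of_int N + (-1/2)))"
    and "e = (\<lambda>K::int. f (-1) (of_int K + (-1)))"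
  have basis: "kn_basis X L Ins A (-1) (f (-1))" "kn_basis X L Ins A (-1/2) (f (-1/2))"
    using kn A unfolding kn_bases_def by blast+
  note sub = kn_basis_subspace[OF basis(1)] kn_basis_subspace[OF basis(2)]
  have zero: "0 \<in> FF X L A (-1)" "0 \<in> FF X L A (-1/2)"
    using sub by (auto intro: sect.subspace_0)
  have e_FF: "e K p \<in> FF X L A (-1)" if "p \<in> Ins" for K p
    unfolding kn_basis_span[OF basis(1)] e_def using that by (intro sect.span_base) blast
  have bil: "bilinear_on_SS X L A c" using c by (simp add: even_super_cocycle_def)
  interpret invariant_odd_form Ins ch "FF X L A (-1/2)" \<phi> e "\<lambda>x y. c (0, x) (0, y)"
  proof
    show "finite Ins" using A by simp
    show "FF X L A (-1/2) = sect.span {\<phi> N p | N p. p \<in> Ins}"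
      unfolding \<phi>_def by (rule kn_basis_span[OF basis(2)])
  next
    fix N p q assume "p \<in> Ins" "q \<in> Ins"
    thus "lead N (if q = p then 1 else 0) (\<phi> N p (ch q))" "\<phi> N p (ch q) meromorphic_on {0}"
      unfolding \<phi>_def using kn_bases_lead[OF kn _ ch, of "-1/2"] by simp_all
  next
    fix K p q assume "p \<in> Ins" "q \<in> Ins"
    thus "lead K (if q = p then 1 else 0) (e K p (ch q))" "e K p (ch q) meromorphic_on {0}"
      unfolding e_def using kn_bases_lead[OF kn _ ch, of "-1"] by simp_all
  next
    fix K p x assume "p \<in> Ins" "x \<in> FF X L A (-1/2)"
    thus "vf_act (e K p) x \<in> FF X L A (-1/2)" by (intro vf_act_FF X L A e_FF)
  next
    fix x y z assume "x \<in> FF X L A (-1/2)" "y \<in> FF X L A (-1/2)" "z \<in> FF X L A (-1/2)"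
    hence "(0, x) \<in> SS X L A" "(0, y) \<in> SS X L A" "(0, z) \<in> SS X L A"
      using zero by (auto simp: SS_def)
    hence "c ((0, x) + (0, y)) (0, z) = c (0, x) (0, z) + c (0, y) (0, z)"
      using bil unfolding bilinear_on_SS_def by blast
    thus "c (0, x + y) (0, z) = c (0, x) (0, z) + c (0, y) (0, z)" by simp
  next
    fix a x z assume "x \<in> FF X L A (-1/2)" "z \<in> FF X L A (-1/2)"
    hence "(0, x) \<in> SS X L A" "(0, z) \<in> SS X L A"
      using zero by (auto simp: SS_def)
    hence "c (super_scale a (0, x)) (0, z) = a * c (0, x) (0, z)"
      using bil unfolding bilinear_on_SS_def by blast
    thus "c (0, sect_scale a x) (0, z) = a * c (0, x) (0, z)" by (simp add: super_scale_def)
  next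
    fix x y assume "x \<in> FF X L A (-1/2)" "y \<in> FF X L A (-1/2)"
    hence "(0, x) \<in> SS_par X L A 1" "(0, y) \<in> SS_par X L A 1"
      by (auto simp: SS_par_def)
    hence "c (0, x) (0, y) = - ((-1) ^ (1 * 1) * c (0, y) (0, x))"
      using c unfolding even_super_cocycle_def by blast
    thus "c (0, x) (0, y) = c (0, y) (0, x)" by simp
  next
    fix K p x y assume *: "p \<in> Ins" "x \<in> FF X L A (-1/2)" "y \<in> FF X L A (-1/2)"
    show "c (0, vf_act (e K p) x) (0, y) + c (0, x) (0, vf_act (e K p) y) = 0"
      by (intro even_super_cocycle_invariant[OF c] e_FF * zero vf_act_FF X L A 0 sect_mult_FF)
  qed
  obtain M2 :: int where M2: "\<And>n m x y. 2 * n \<in> \<int> \<Longrightarrow> 2 * m \<in> \<int> \<Longrightarrow> x \<in> SS_deg Ins f n \<Longrightarrow>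
      y \<in> SS_deg Ins f m \<Longrightarrow> c x y \<noteq> 0 \<Longrightarrow> n + m \<le> of_int M2"
    using bd unfolding bounded_above_def by blast
  \<comment> \<open>\<open>\<phi> N p\<close> and \<open>\<phi> M r\<close> have degrees \<open>N - 1/2\<close> and \<open>M - 1/2\<close>, so total degree above \<open>M2\<close>
    means \<open>N + M \<ge> M2 + 2\<close>.\<close>
  have "vanishes_from (M2 + 2)"
    unfolding vanishes_from_def
  proof (intro allI ballI impI)
    fix N M p r assume *: "p \<in> Ins" "r \<in> Ins" "M2 + 2 \<le> N + M"
    have deg: "(0, \<phi> N p) \<in> SS_deg Ins f (of_int N + (-1/2))"
         "2 * (of_int N + (-1/2)) \<in> (\<int> :: real set)" if "p \<in> Ins" for N p
    proof -
      have two: "2 * (of_int N + (-1/2)) = real_of_int (2 * N - 1)" by simp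
      thus "2 * (of_int N + (-1/2)) \<in> (\<int> :: real set)" by (metis Ints_of_int)
      have "of_int N + (-1/2) \<notin> (\<int> :: real set)"
      proof
        assume "of_int N + (-1/2) \<in> (\<int> :: real set)"
        then obtain k where "of_int N + (-1/2) = real_of_int k" by (elim Ints_cases)
        hence "2 * N - 1 = 2 * k" using two by linarith
        thus False by presburger
      qed
      thus "(0, \<phi> N p) \<in> SS_deg Ins f (of_int N + (-1/2))"
        unfolding SS_deg_def \<phi>_def using that by (auto intro: sect.span_base)
    qed
    show "c (0, \<phi> N p) (0, \<phi> M r) = 0"
    proof (rule ccontr)
      assume "c (0, \<phi> N p) (0, \<phi> M r) \<noteq> 0"
      from M2[OF deg(2)[OF *(1)] deg(2)[OF *(2)] deg(1)[OF *(1)] deg(1)[OF *(2)] this]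
      show False using *(3) by linarith
    qed
  qed
  note odd = bounded_imp_zero[OF this]
  obtain e1 x1 e2 x2 where xy: "x = (e1, x1)" "y = (e2, x2)" by (cases x, cases y)
  have m: "e1 \<in> FF X L A (-1)" "x1 \<in> FF X L A (-1/2)" "e2 \<in> FF X L A (-1)" "x2 \<in> FF X L A (-1/2)"
    using x y by (auto simp: SS_def xy)
  have S: "(e1, 0) \<in> SS X L A" "(0, x1) \<in> SS X L A" "(e2, 0) \<in> SS X L A" "(0, x2) \<in> SS X L A"
    using m zero by (auto simp: SS_def)
  have par: "(e1, 0) \<in> SS_par X L A 0" "(0, x1) \<in> SS_par X L A 1"
      "(e2, 0) \<in> SS_par X L A 0" "(0, x2) \<in> SS_par X L A 1"
    using m by (auto simp: SS_par_def)
  have "\<forall>k \<in> {0, 1}. \<forall>l \<in> {0, 1}. \<forall>x \<in> SS_par X L A k. \<forall>y \<in> SS_par X L A l. k \<noteq> l \<longrightarrow> c x y = 0"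
    using c unfolding even_super_cocycle_def by blast
  hence mixed: "c (e1, 0) (0, x2) = 0" "c (0, x1) (e2, 0) = 0"
    using par by simp_all
  have split: "x = (e1, 0) + (0, x1)" "y = (e2, 0) + (0, x2)" by (simp_all add: xy)
  have add: "c (u + v) w = c u w + c v w" "c w (u + v) = c w u + c w v"
    if "u \<in> SS X L A" "v \<in> SS X L A" "w \<in> SS X L A" for u v w
    using bil that unfolding bilinear_on_SS_def by blast+
  have "c x y = c (e1, 0) y + c (0, x1) y"
    unfolding split(1) using S y by (intro add)
  moreover have "c (e1, 0) y = c (e1, 0) (e2, 0) + c (e1, 0) (0, x2)"
    unfolding split(2) using S by (intro add)
  moreover have "c (0, x1) y = c (0, x1) (e2, 0) + c (0, x1) (0, x2)"
    unfolding split(2) using S by (intro add)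
  ultimately show ?thesis using mixed 0[OF m(1,3)] odd[OF m(2,4)] by simp
qed

lemma even_super_cocycle_diff:
  assumes "even_super_cocycle X L A c1" "even_super_cocycle X L A c2"
  shows "even_super_cocycle X L A (\<lambda>x y. c1 x y - c2 x y)"
proof -
  have bil: "bilinear_on_SS X L A c1" "bilinear_on_SS X L A c2"
    using assms by (simp_all add: even_super_cocycle_def)
  have diff_bil: "bilinear_on_SS X L A (\<lambda>x y. c1 x y - c2 x y)"
    unfolding bilinear_on_SS_def
  proof (intro ballI allI, goal_cases)
    case (1 x y z a)
    have "c (x + y) z = c x z + c y z \<and> c z (x + y) = c z x + c z y \<and>
        c (super_scale a x) z = a * c x z \<and> c z (super_scale a x) = a * c z x"
      if "bilinear_on_SS X L A c" for c
      using that 1 unfolding bilinear_on_SS_def by blast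
    from this[OF bil(1)] this[OF bil(2)] show ?case by (simp add: algebra_simps)
  qed
  have diff_sym: "(k \<noteq> l \<longrightarrow> c1 x y - c2 x y = 0) \<and>
       c1 x y - c2 x y = - ((-1) ^ (k * l) * (c1 y x - c2 y x))"
    if "k \<in> {0, 1}" "l \<in> {0, 1}" "x \<in> SS_par X L A k" "y \<in> SS_par X L A l" for k l x y
  proof -
    have "(k \<noteq> l \<longrightarrow> c x y = 0) \<and> c x y = - ((-1) ^ (k * l) * c y x)"
      if "even_super_cocycle X L A c" for c
      using that \<open>k \<in> _\<close> \<open>l \<in> _\<close> \<open>x \<in> _\<close> \<open>y \<in> _\<close> unfolding even_super_cocycle_def by blast
    from this[OF assms(1)] this[OF assms(2)] show ?thesis by (auto simp: algebra_simps)
  qed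
  have diff_jacobi: "(-1) ^ (k * m) * (c1 x (super_bracket y z) - c2 x (super_bracket y z))
        + (-1) ^ (l * k) * (c1 y (super_bracket z x) - c2 y (super_bracket z x))
        + (-1) ^ (m * l) * (c1 z (super_bracket x y) - c2 z (super_bracket x y)) = 0"
    if klm: "k \<in> {0, 1}" "l \<in> {0, 1}" "m \<in> {0, 1}" and
      xyz: "x \<in> SS_par X L A k" "y \<in> SS_par X L A l" "z \<in> SS_par X L A m" for k l m x y z
  proof -
    have "(-1) ^ (k * m) * c x (super_bracket y z)
        + (-1) ^ (l * k) * c y (super_bracket z x)
        + (-1) ^ (m * l) * c z (super_bracket x y) = 0"
      if "even_super_cocycle X L A c" for c
      using that klm xyz unfolding even_super_cocycle_def by blast
    from arg_cong2[where f = minus, OF this[OF assms(1)] this[OF assms(2)]] show ?thesis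
      by (simp add: algebra_simps)
  qed
  show ?thesis
    unfolding even_super_cocycle_def
  proof (intro conjI ballI impI, goal_cases)
    case 1
    show ?case by (rule diff_bil)
  next
    case (2 k l x y)
    thus ?case using diff_sym[of k l x y] by blast
  next
    case (3 k l x y)
    thus ?case using diff_sym[of k l x y] by blast
  next
    case (4 k l m x y z)
    thus ?case by (rule diff_jacobi)
  qed
qed

lemma bounded_above_diff:
  assumes "bounded_above Ins f c1" "bounded_above Ins f c2"
  shows "bounded_above Ins f (\<lambda>x y. c1 x y - c2 x y)"
proof -
  obtain M1 :: int where 1:
    "\<And>n m x y. 2 * n \<in> \<int> \<Longrightarrow> 2 * m \<in> \<int> \<Longrightarrow> x \<in> SS_deg Ins f n \<Longrightarrow>
      y \<in> SS_deg Ins f m \<Longrightarrow> c1 x y \<noteq> 0 \<Longrightarrow> n + m \<le> of_int M1"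
    using assms(1) unfolding bounded_above_def by blast
  obtain M2 :: int where 2:
    "\<And>n m x y. 2 * n \<in> \<int> \<Longrightarrow> 2 * m \<in> \<int> \<Longrightarrow> x \<in> SS_deg Ins f n \<Longrightarrow>
      y \<in> SS_deg Ins f m \<Longrightarrow> c2 x y \<noteq> 0 \<Longrightarrow> n + m \<le> of_int M2"
    using assms(2) unfolding bounded_above_def by blast
  show ?thesis
    unfolding bounded_above_def
  proof (intro exI[of _ "max M1 M2"] allI impI, elim bexE)
    fix n m :: real and x y
    assume "2 * n \<in> \<int>" "2 * m \<in> \<int>" "x \<in> SS_deg Ins f n" "y \<in> SS_deg Ins f m"
      and "c1 x y - c2 x y \<noteq> 0"
    hence "n + m \<le> of_int M1 \<or> n + m \<le> of_int M2"
      using 1 2 by (cases "c1 x y = 0") auto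
    thus "n + m \<le> of_int (max M1 M2)" by auto
  qed
qed

theorem proposition5p4:
  fixes X :: "('a::t2_space, 'i) atlas"
    and L :: "('a, 'i) transition"
    and Ins Outs A :: "'a set"
    and ch :: "'a \<Rightarrow> 'i"
    and C :: "'a chain"
    and f :: "real \<Rightarrow> real \<Rightarrow> 'a \<Rightarrow> 'i sect"
  assumes "compact_riemann_surface X"
    and "theta_characteristic X L"
    and "finite A" and "A = Ins \<union> Outs"
    and "Ins \<noteq> {}" and "Outs \<noteq> {}" and "Ins \<inter> Outs = {}"
    and "\<forall>p \<in> Ins. p \<in> chart_dom X (ch p) \<and> chart_map X (ch p) p = 0"
    and "separating_cycle X Ins A ch C"
    and "kn_bases X L Ins Outs ch C f"
  shows "(\<forall>c. even_super_cocycle X L A c \<and> bounded_above Ins f c \<and>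
              (\<forall>e \<in> FF X L A (-1). \<forall>g \<in> FF X L A (-1). c (e, 0) (g, 0) = 0) \<longrightarrow>
              (\<forall>x \<in> SS X L A. \<forall>y \<in> SS X L A. c x y = 0)) \<and>
         (\<forall>c1 c2. even_super_cocycle X L A c1 \<and> bounded_above Ins f c1 \<and>
              even_super_cocycle X L A c2 \<and> bounded_above Ins f c2 \<and>
              (\<forall>e \<in> FF X L A (-1). \<forall>g \<in> FF X L A (-1). c1 (e, 0) (g, 0) = c2 (e, 0) (g, 0)) \<longrightarrow>
              (\<forall>x \<in> SS X L A. \<forall>y \<in> SS X L A. c1 x y = c2 x y))"
proof -
  have "riemann_surface X"
    using assms(1) by (simp add: compact_riemann_surface_def)
  note zero = bounded_cocycle_zero[OF this assms(2,3,4,8,10)]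
  show ?thesis
  proof (intro conjI allI impI ballI; elim conjE)
    fix c x y
    assume "even_super_cocycle X L A c" "bounded_above Ins f c" "x \<in> SS X L A" "y \<in> SS X L A"
      "\<forall>e \<in> FF X L A (-1). \<forall>g \<in> FF X L A (-1). c (e, 0) (g, 0) = 0"
    thus "c x y = 0" by (blast intro: zero[of c])
  next
    fix c1 c2 x y
    assume "even_super_cocycle X L A c1" "bounded_above Ins f c1"
      "even_super_cocycle X L A c2" "bounded_above Ins f c2" "x \<in> SS X L A" "y \<in> SS X L A"
      "\<forall>e \<in> FF X L A (-1). \<forall>g \<in> FF X L A (-1). c1 (e, 0) (g, 0) = c2 (e, 0) (g, 0)"
    note c12 = this
    have "c1 x y - c2 x y = 0"
      by (rule zero[of "\<lambda>x y. c1 x y - c2 x y"])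
         (use c12 in \<open>simp_all add: even_super_cocycle_diff bounded_above_diff\<close>)
    thus "c1 x y = c2 x y" by simp
  qed
qed

end
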